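(* Let $k,\ell$ be positive integers and, for $1\le i\le k$ and $0\le j\le \ell$, let $x_{i,j}$ be fixed rational numbers. For every positive integer $n$ set $$s_n := \sum_{i=1}^k \prod_{j=0}^{\ell} x_{i,j}^{\,n^j}.$$ Then the sequence $(\omega(s_n))_{n\ge 1}$ is bounded if and only if there exist non-zero rationals $a_0,b_0,\ldots,a_\ell,b_\ell$ such that $s_{2n}=\prod_{j=0}^{\ell} a_j^{(2n)^j}$ and $s_{2n-1}=\prod_{j=0}^{\ell} b_j^{(2n-1)^j}$ for all positive integers $n$.
   Context: For a non-zero integer $x$, $\omega(x)$ is the number of distinct (positive) prime divisors of $x$, and $\omega(0):=\infty$. For $x\in\mathbf Z$ and a positive integer $y$, one sets $\omega(x/y):=\omega(x/\delta)+\omega(y/\delta)$ where $\delta=\gcd(x,y)$. "Bounded" means bounded above by a finite constant. *)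

theory Defs
  imports "HOL-Computational_Algebra.Primes" "HOL-Library.Extended_Nat"
begin

definition omega_int :: "int \<Rightarrow> enat" where
  "omega_int x = (if x = 0 then \<infinity> else enat (card (prime_factors x)))"

text \<open>\<^const>\<open>quotient_of\<close> returns the reduced fraction with positive denominator; the lemma
  \<open>omega_rat_Fract\<close> below covers arbitrary fractions.\<close>

definition omega_rat :: "rat \<Rightarrow> enat" where
  "omega_rat r = (case quotient_of r of (p, q) \<Rightarrow> omega_int p + omega_int q)"

lemma omega_rat_Fract:
  assumes "y > 0"
  shows "omega_rat (Fract x y) = omega_int (x div gcd x y) + omega_int (y div gcd x y)"
  using assms by (simp add: omega_rat_def quotient_of_Fract Rat.normalize_def Let_def)

definition exp_poly_sum :: "nat \<Rightarrow> nat \<Rightarrow> (nat \<Rightarrow> nat \<Rightarrow> rat) \<Rightarrow> nat \<Rightarrow> rat" where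
  "exp_poly_sum k l x n = (\<Sum>i=1..k. \<Prod>j=0..l. x i j ^ (n ^ j))"

end

theory Submission
  imports Defs "HOL-Number_Theory.Number_Theory"
begin

text \<open>
  If \<open>s\<close> is given by the two products, then only the primes occurring in the finitely many numbers
  \<open>a\<^sub>j\<close>, \<open>b\<^sub>j\<close> can divide a numerator or denominator of \<open>s\<^sub>n\<close>, so \<open>\<omega>(s\<^sub>n)\<close> is bounded.

  For the converse, fix the parity of \<open>n\<close>. Then the sign of every summand is constant. Drop the
  summands with a zero factor, and merge those whose absolute bases for \<open>j \<ge> 1\<close> agree. This writes
  \<open>s\<^sub>n\<close> as a sum of terms \<open>c\<^sub>t \<Prod>\<^sub>j t\<^sub>j^(n^j)\<close> over a finite set of distinct tuples \<open>t\<close> of positive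
  rationals, with \<open>c\<^sub>t \<noteq> 0\<close> (\<open>exp_poly_sum_grouped\<close>). With no tuple left, \<open>s\<^sub>n = 0\<close> and
  \<open>\<omega>(s\<^sub>n) = \<infinity>\<close>. With exactly one, the sum is the product wanted. It remains to see that \<open>\<omega>\<close> is
  unbounded when there are at least two tuples; clearing denominators, the bases and the
  coefficients may be taken to be integers.

  So let \<open>f(n) = \<Sum>\<^sub>i c\<^sub>i U\<^sub>i(n)\<close> with \<open>U\<^sub>i(n) = \<Prod>\<^sub>j y\<^sub>i\<^sub>j^(n^j)\<close>. Both \<open>ln U\<^sub>i(n)\<close> and the \<open>q\<close>-adic valuations of
  \<open>U\<^sub>i(n)\<close> are polynomials in \<open>n\<close> without constant term, and two different ones drift apart to
  infinity. Two consequences are used.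

  \<^item> One term \<open>U\<^sub>M\<close> dominates in size, so \<open>\<bar>f(n)\<bar> \<ge> U\<^sub>M(n) / 2\<close> for large \<open>n\<close>; the same applied to
    partial sums shows that none of them vanishes for large \<open>n\<close> (\<open>dominant_term\<close>).

  \<^item> For a prime \<open>q\<close>, let \<open>P\<^sub>q\<close> be the least of the valuations. The terms attaining it, divided by
    \<open>q^P\<^sub>q(n)\<close>, form a sum that is periodic in \<open>n\<close> modulo any power of \<open>q\<close>, and all other terms are
    eventually negligible \<open>q\<close>-adically. Hence the valuation of \<open>f(n)\<close> stays below \<open>P\<^sub>q(n)\<close> plus a
    constant when \<open>n\<close> runs through a suitable residue class (\<open>multiplicity_bounded_in_progression\<close>).

  Let \<open>Q\<close> be a finite set of primes containing those that divide a base. If \<open>f(n)\<close> had only prime factors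
  from \<open>Q\<close> for \<open>n\<close> in the intersection of these classes, then \<open>\<bar>f(n)\<bar>\<close> would be at most a constant times
  \<open>\<Prod>\<^sub>q q^P\<^sub>q(n)\<close>. But \<open>U\<^sub>M(n)\<close> is a multiple of this product for large \<open>n\<close>, and the quotient tends to
  infinity since there are at least two different terms.
  So a prime outside \<open>Q\<close> appears (\<open>new_prime_factor\<close>). Choosing the residue class such that the primes
  already dividing \<open>f(n)\<close> persist, the number of prime factors grows by one in each step
  (\<open>unboundedly_many_prime_factors\<close>).
\<close>

section \<open>Polynomials without constant term and their order of growth\<close>

definition exponent :: "nat \<Rightarrow> (nat \<Rightarrow> real) \<Rightarrow> nat \<Rightarrow> real" where
  "exponent l a n = (\<Sum>j=1..l. a j * real n ^ j)"

lemma exponent_diff: "exponent l a n - exponent l b n = exponent l (\<lambda>j. a j - b j) n"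
  by (simp add: exponent_def sum_subtractf left_diff_distrib)

lemma exponent_uminus: "exponent l (\<lambda>j. - a j) n = - exponent l a n"
  by (simp add: exponent_def sum_negf)

lemma exponent_cong: "(\<And>j. j \<in> {1..l} \<Longrightarrow> a j = b j) \<Longrightarrow> exponent l a n = exponent l b n"
  unfolding exponent_def by (rule sum.cong) auto

text \<open>The next power of \<open>n\<close> beats all lower ones; this makes the leading coefficient decide the limit.\<close>

lemma exponent_over_power_tendsto_0: "((\<lambda>n. exponent l a n / real n ^ Suc l) \<longlongrightarrow> 0) sequentially"
proof -
  have "((\<lambda>n. a j * real n ^ j / real n ^ Suc l) \<longlongrightarrow> 0) sequentially" if "j \<in> {1..l}" for j
  proof -
    have "((\<lambda>n. inverse (real n) ^ (Suc l - j)) \<longlongrightarrow> 0 ^ (Suc l - j)) sequentially"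
      by (intro tendsto_power lim_inverse_n)
    moreover have "0 ^ (Suc l - j) = (0::real)" using that by simp
    ultimately have "((\<lambda>n. a j * inverse (real n) ^ (Suc l - j)) \<longlongrightarrow> a j * 0) sequentially"
      by (intro tendsto_mult_left) simp
    moreover have "\<forall>\<^sub>F n in sequentially. a j * inverse (real n) ^ (Suc l - j) = a j * real n ^ j / real n ^ Suc l"
    proof (rule eventually_sequentiallyI[of 1])
      fix n :: nat assume "1 \<le> n"
      then have "real n ^ Suc l = real n ^ j * real n ^ (Suc l - j)"
        using that by (simp flip: power_add)
      with \<open>1 \<le> n\<close> show "a j * inverse (real n) ^ (Suc l - j) = a j * real n ^ j / real n ^ Suc l"
        by (simp add: field_simps power_inverse)
    qed
    ultimately show ?thesis by (simp add: filterlim_cong)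
  qed
  then have "((\<lambda>n. \<Sum>j=1..l. a j * real n ^ j / real n ^ Suc l) \<longlongrightarrow> (\<Sum>j=1..l. 0)) sequentially"
    by (intro tendsto_sum)
  then show ?thesis by (simp add: exponent_def sum_divide_distrib)
qed

lemma exponent_tends_to_infinity:
  assumes "\<exists>j\<in>{1..l}. a j \<noteq> 0"
  shows "filterlim (exponent l a) at_top sequentially \<or> filterlim (exponent l a) at_bot sequentially"
  using assms
proof (induction l)
  case (Suc l)
  have split: "exponent (Suc l) a n = exponent l a n + a (Suc l) * real n ^ Suc l" for n
    by (simp add: exponent_def)
  show ?case
  proof (cases "a (Suc l) = 0")
    case True
    then have "\<exists>j\<in>{1..l}. a j \<noteq> 0" using Suc.prems by (metis atLeastAtMost_iff le_Suc_eq)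
    moreover have "exponent (Suc l) a = exponent l a" using split True by auto
    ultimately show ?thesis using Suc.IH by simp
  next
    case False
    let ?q = "\<lambda>n. exponent l a n / real n ^ Suc l + a (Suc l)"
    have lim: "(?q \<longlongrightarrow> a (Suc l)) sequentially"
      using tendsto_add[OF exponent_over_power_tendsto_0 tendsto_const] by simp
    have top: "filterlim (\<lambda>n. real n ^ Suc l) at_top sequentially"
      by (intro filterlim_pow_at_top filterlim_real_sequentially) simp
    have eq: "\<forall>\<^sub>F n in sequentially. ?q n * real n ^ Suc l = exponent (Suc l) a n"
      by (rule eventually_sequentiallyI[of 1]) (simp add: split field_simps)
    show ?thesis
    proof (cases "a (Suc l) > 0")
      case True
      from filterlim_tendsto_pos_mult_at_top[OF lim True top]
      show ?thesis using filterlim_cong[OF refl refl eq] by blast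
    next
      case neg: False
      with False have "a (Suc l) < 0" by simp
      from filterlim_tendsto_neg_mult_at_bot[OF lim this top]
      show ?thesis using filterlim_cong[OF refl refl eq] by blast
    qed
  qed
qed simp

text \<open>
  Growth is a total preorder on the polynomials, in which only equal polynomials tie. Equality of the
  coefficients is the useful form of a tie: there is no constant term, hence no pair of polynomials
  at bounded but non-zero distance.
\<close>

lemma eventually_greatest_exponent:
  assumes "finite J" "J \<noteq> {}"
  shows "\<exists>m\<in>J. \<forall>i\<in>J. (\<forall>j\<in>{1..l}. a i j = a m j) \<or>
           filterlim (\<lambda>n. exponent l (a m) n - exponent l (a i) n) at_top sequentially"
  using assms
proof (induction rule: finite_ne_induct)
  case (singleton i)
  then show ?case by simp
next
  case (insert i J)
  then obtain m where m: "m \<in> J" "\<And>i'. i' \<in> J \<Longrightarrow> (\<forall>j\<in>{1..l}. a i' j = a m j) \<or>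
       filterlim (\<lambda>n. exponent l (a m) n - exponent l (a i') n) at_top sequentially"
    by blast
  let ?d = "exponent l (\<lambda>j. a m j - a i j)"
  have "(\<forall>j\<in>{1..l}. a i j = a m j) \<or> (\<exists>j\<in>{1..l}. a m j - a i j \<noteq> 0)" by force
  then consider "\<forall>j\<in>{1..l}. a i j = a m j" | "filterlim ?d at_top sequentially"
    | "filterlim ?d at_bot sequentially"
    using exponent_tends_to_infinity[of l "\<lambda>j. a m j - a i j"] by blast
  then show ?case
  proof cases
    case 1
    then show ?thesis using m by blast
  next
    case 2
    then show ?thesis using m unfolding exponent_diff by blast
  next
    case 3
    then have i_over_m: "filterlim (\<lambda>n. exponent l (a i) n - exponent l (a m) n) at_top sequentially"
      by (simp add: filterlim_uminus_at_bot exponent_diff flip: exponent_uminus)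
    have "filterlim (\<lambda>n. exponent l (a i) n - exponent l (a i') n) at_top sequentially" if "i' \<in> J" for i'
      using m(2)[OF that]
    proof
      assume "\<forall>j\<in>{1..l}. a i' j = a m j"
      then show ?thesis using i_over_m exponent_cong[of l "a i'" "a m"] by simp
    next
      assume "filterlim (\<lambda>n. exponent l (a m) n - exponent l (a i') n) at_top sequentially"
      from filterlim_at_top_add_at_top[OF i_over_m this] show ?thesis by simp
    qed
    then show ?thesis by blast
  qed
qed

lemma eventually_least_exponent:
  assumes "finite J" "J \<noteq> {}"
  shows "\<exists>m\<in>J. \<forall>i\<in>J. (\<forall>j\<in>{1..l}. a i j = a m j) \<or>
           filterlim (\<lambda>n. exponent l (a i) n - exponent l (a m) n) at_top sequentially"
  using eventually_greatest_exponent[OF assms, of l "\<lambda>i j. - a i j"]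
  by (simp add: exponent_uminus)

section \<open>Products of super-powers\<close>

definition superpow :: "nat \<Rightarrow> (nat \<Rightarrow> 'a::comm_semiring_1) \<Rightarrow> nat \<Rightarrow> 'a" where
  "superpow l y n = (\<Prod>j=1..l. y j ^ (n ^ j))"

lemma superpow_mult: "superpow l (\<lambda>j. y j * z j) n = superpow l y n * superpow l z n"
  by (simp add: superpow_def power_mult_distrib prod.distrib)

lemma superpow_cong: "(\<And>j. j \<in> {1..l} \<Longrightarrow> y j = z j) \<Longrightarrow> superpow l y n = superpow l z n"
  unfolding superpow_def by (rule prod.cong) auto

lemma of_nat_superpow: "of_nat (superpow l y n) = superpow l (\<lambda>j. of_nat (y j)) n"
  by (simp add: superpow_def)

lemma superpow_pos:
  fixes y :: "nat \<Rightarrow> 'a::linordered_semidom"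
  assumes "\<And>j. j \<in> {1..l} \<Longrightarrow> 0 < y j"
  shows "0 < superpow l y n"
  using assms by (auto simp: superpow_def intro!: prod_pos)

lemma ln_superpow:
  assumes "\<And>j. j \<in> {1..l} \<Longrightarrow> 0 < y j"
  shows "ln (real (superpow l y n)) = exponent l (\<lambda>j. ln (real (y j))) n"
proof -
  have "ln (real (superpow l y n)) = (\<Sum>j=1..l. ln (real (y j) ^ (n ^ j)))"
    unfolding superpow_def of_nat_prod by (subst ln_prod) (use assms in \<open>auto\<close>)
  also have "\<dots> = exponent l (\<lambda>j. ln (real (y j))) n"
    unfolding exponent_def using assms by (intro sum.cong) (auto simp: ln_realpow)
  finally show ?thesis .
qed

lemma multiplicity_superpow:
  fixes y :: "nat \<Rightarrow> nat"
  assumes "prime q" "\<And>j. j \<in> {1..l} \<Longrightarrow> 0 < y j"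
  shows "multiplicity q (superpow l y n) = (\<Sum>j=1..l. multiplicity q (y j) * n ^ j)"
proof -
  have nz: "y j \<noteq> 0" if "j \<in> {1..l}" for j using assms(2)[OF that] by simp
  then have "0 \<notin> (\<lambda>j. y j ^ (n ^ j)) ` {1..l}" by force
  then have "multiplicity q (superpow l y n) = (\<Sum>j=1..l. multiplicity q (y j ^ (n ^ j)))"
    unfolding superpow_def using assms(1)
    by (intro prime_elem_multiplicity_prod_distrib) auto
  also have "\<dots> = (\<Sum>j=1..l. multiplicity q (y j) * n ^ j)"
    using assms(1) nz
    by (intro sum.cong refl) (simp add: prime_elem_multiplicity_power_distrib)
  finally show ?thesis .
qed

lemma real_multiplicity_superpow:
  fixes y :: "nat \<Rightarrow> nat"
  assumes "prime q" "\<And>j. j \<in> {1..l} \<Longrightarrow> 0 < y j"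
  shows "real (multiplicity q (superpow l y n)) = exponent l (\<lambda>j. real (multiplicity q (y j))) n"
  by (subst multiplicity_superpow) (use assms in \<open>simp_all add: exponent_def\<close>)

text \<open>
  By Euler's theorem, the exponents \<open>n ^ j\<close> matter only modulo \<open>totient m\<close>, and they are determined
  there by the residue of \<open>n\<close>.
\<close>

lemma superpow_cong_mod:
  fixes y :: "nat \<Rightarrow> nat"
  assumes "\<And>j. j \<in> {1..l} \<Longrightarrow> coprime (y j) m" "[n = n'] (mod totient m)"
  shows "[superpow l y n = superpow l y n'] (mod m)"
  unfolding superpow_def
proof (rule cong_prod)
  fix j assume j: "j \<in> {1..l}"
  have "[n ^ j = n' ^ j] (mod ord m (y j))"
    using assms(2) order_divides_totient[of m "y j"] assms(1)[OF j]
    by (intro cong_pow) (metis cong_dvd_modulus_nat coprime_commute)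
  then show "[y j ^ (n ^ j) = y j ^ (n' ^ j)] (mod m)"
    using assms(1)[OF j] by (subst order_divides_expdiff) (auto simp: coprime_commute)
qed

lemma filterlim_sum_zero_or_at_top:
  fixes g :: "'q \<Rightarrow> 'n \<Rightarrow> real"
  assumes "finite Q" and g: "\<And>q. q \<in> Q \<Longrightarrow> (\<forall>n. g q n = 0) \<or> filterlim (g q) at_top F"
    and "q0 \<in> Q" and q0: "filterlim (g q0) at_top F"
  shows "filterlim (\<lambda>n. \<Sum>q\<in>Q. g q n) at_top F"
proof (rule filterlim_at_top_mono[OF q0])
  have "\<forall>\<^sub>F n in F. 0 \<le> g q n" if "q \<in> Q" for q
    using g[OF that]
  proof
    assume "filterlim (g q) at_top F"
    then show ?thesis by (simp add: filterlim_at_top)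
  qed simp
  then have "\<forall>\<^sub>F n in F. \<forall>q\<in>Q. 0 \<le> g q n"
    using \<open>finite Q\<close> by (simp add: eventually_ball_finite)
  then show "\<forall>\<^sub>F n in F. g q0 n \<le> (\<Sum>q\<in>Q. g q n)"
    by (rule eventually_mono) (use assms in \<open>auto intro!: member_le_sum\<close>)
qed

section \<open>Size and prime factors of an integer\<close>

lemma nat_eq_prod_prime_powers:
  fixes x :: nat
  assumes "x \<noteq> 0" "finite Q" "\<And>q. q \<in> Q \<Longrightarrow> prime q" "prime_factors x \<subseteq> Q"
  shows "x = (\<Prod>q\<in>Q. q ^ multiplicity q x)"
proof -
  have "x = (\<Prod>q\<in>prime_factors x. q ^ multiplicity q x)"
    using assms(1) by (simp add: prod_prime_factors)
  also have "\<dots> = (\<Prod>q\<in>Q. q ^ multiplicity q x)"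
    using assms by (intro prod.mono_neutral_left)
      (auto simp: prime_factors_multiplicity)
  finally show ?thesis .
qed

lemma ln_eq_sum_multiplicity:
  fixes x :: nat
  assumes "x \<noteq> 0" "finite Q" "\<And>q. q \<in> Q \<Longrightarrow> prime q" "prime_factors x \<subseteq> Q"
  shows "ln (real x) = (\<Sum>q\<in>Q. ln (real q) * real (multiplicity q x))"
proof -
  have pos: "0 < q" if "q \<in> Q" for q using assms(3)[OF that] prime_gt_0_nat by blast
  have "ln (real x) = ln (real (\<Prod>q\<in>Q. q ^ multiplicity q x))"
    using nat_eq_prod_prime_powers[OF assms] by (rule arg_cong)
  also have "\<dots> = (\<Sum>q\<in>Q. ln (real q ^ multiplicity q x))"
    using pos assms(2) by (simp add: ln_prod)
  also have "\<dots> = (\<Sum>q\<in>Q. ln (real q) * real (multiplicity q x))"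
    using pos by (intro sum.cong) (simp_all add: ln_realpow)
  finally show ?thesis .
qed

text \<open>
  New primes are found through this bound: a number that exceeds it, while the powers \<open>q ^ k q\<close> do
  not divide it, must have a prime factor outside \<open>Q\<close>.
\<close>

lemma ln_le_if_prime_powers_not_dvd:
  fixes x :: nat
  assumes "x \<noteq> 0" "finite Q" "\<And>q. q \<in> Q \<Longrightarrow> prime q" "prime_factors x \<subseteq> Q"
    and not_dvd: "\<And>q. q \<in> Q \<Longrightarrow> \<not> q ^ k q dvd x"
  shows "ln (real x) \<le> (\<Sum>q\<in>Q. ln (real q) * real (k q))"
proof -
  have "ln (real x) = (\<Sum>q\<in>Q. ln (real q) * real (multiplicity q x))"
    using assms(1-4) by (rule ln_eq_sum_multiplicity)
  also have "\<dots> \<le> (\<Sum>q\<in>Q. ln (real q) * real (k q))"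
  proof (intro sum_mono mult_left_mono)
    fix q assume q: "q \<in> Q"
    show "real (multiplicity q x) \<le> real (k q)"
      using not_dvd[OF q] multiplicity_dvd'[of "k q" q x] by (cases "k q \<le> multiplicity q x") auto
    show "0 \<le> ln (real q)" using prime_gt_0_nat[OF assms(3)[OF q]] by simp
  qed
  finally show ?thesis .
qed

lemma finite_natural_divisors:
  fixes z :: int
  assumes "z \<noteq> 0"
  shows "finite {q. int q dvd z}"
proof (rule finite_subset)
  show "{q. int q dvd z} \<subseteq> {..nat \<bar>z\<bar>}"
    using assms by (auto dest!: dvd_imp_le_int)
qed simp

section \<open>Integral sums of super-powers: size and valuations\<close>

locale superpower_sum =
  fixes l :: nat and I :: "'i set" and y :: "'i \<Rightarrow> nat \<Rightarrow> nat" and c :: "'i \<Rightarrow> int"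
  assumes finite_I: "finite I"
    and base_pos: "i \<in> I \<Longrightarrow> j \<in> {1..l} \<Longrightarrow> 0 < y i j"
    and coeff_nonzero: "i \<in> I \<Longrightarrow> c i \<noteq> 0"
    and bases_distinct: "i \<in> I \<Longrightarrow> i' \<in> I \<Longrightarrow> i \<noteq> i' \<Longrightarrow> \<exists>j\<in>{1..l}. y i j \<noteq> y i' j"
begin

definition partial_sum :: "'i set \<Rightarrow> nat \<Rightarrow> int" where
  "partial_sum J n = (\<Sum>i\<in>J. c i * int (superpow l (y i) n))"

lemma term_pos: "i \<in> I \<Longrightarrow> 0 < superpow l (y i) n"
  by (intro superpow_pos base_pos)

text \<open>
  The bases are distinct, so exactly one \<open>ln\<close> of a term grows fastest. Dividing the sum by this
  term leaves the limit \<open>c m\<close>, a non-zero integer, whence the factor \<open>1 / 2\<close>. The statement is about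
  every subset \<open>J\<close>, because the terms of least \<open>q\<close>-adic valuation must not cancel either.
\<close>

lemma dominant_term:
  assumes "J \<subseteq> I" "J \<noteq> {}"
  shows "\<exists>m\<in>J. (\<forall>i\<in>J. i \<noteq> m \<longrightarrow> filterlim (\<lambda>n. ln (real (superpow l (y m) n)) - ln (real (superpow l (y i) n))) at_top sequentially)
     \<and> (\<forall>\<^sub>F n in sequentially. real (superpow l (y m) n) / 2 \<le> \<bar>real_of_int (partial_sum J n)\<bar>)"
proof -
  have finJ: "finite J" using assms finite_I finite_subset by blast
  define a where "a i j = ln (real (y i j))" for i j
  have ln_term: "ln (real (superpow l (y i) n)) = exponent l (a i) n" if "i \<in> J" for i n
    unfolding a_def using assms(1) that base_pos by (intro ln_superpow) blast
  obtain m where m: "m \<in> J" "\<And>i. i \<in> J \<Longrightarrow> (\<forall>j\<in>{1..l}. a i j = a m j) \<or>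
      filterlim (\<lambda>n. exponent l (a m) n - exponent l (a i) n) at_top sequentially"
    using eventually_greatest_exponent[OF finJ assms(2), of l a] by blast
  have dom: "filterlim (\<lambda>n. exponent l (a m) n - exponent l (a i) n) at_top sequentially"
    if i: "i \<in> J" "i \<noteq> m" for i
  proof -
    obtain j where j: "j \<in> {1..l}" "y i j \<noteq> y m j"
      using bases_distinct[of i m] i m assms by blast
    moreover have "0 < y i j" "0 < y m j" using base_pos assms(1) i(1) m(1) j(1) by blast+
    ultimately have "a i j \<noteq> a m j" by (simp add: a_def)
    then show ?thesis using m(2)[OF i(1)] j by blast
  qed
  let ?U = "\<lambda>i n. real (superpow l (y i) n)"
  have ratio: "((\<lambda>n. ?U i n / ?U m n) \<longlongrightarrow> 0) sequentially" if i: "i \<in> J" "i \<noteq> m" for i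
  proof -
    have "((\<lambda>n. exp (- (exponent l (a m) n - exponent l (a i) n))) \<longlongrightarrow> 0) sequentially"
      by (intro filterlim_compose[OF exp_at_bot] filterlim_compose[OF filterlim_uminus_at_bot_at_top] dom i)
    moreover have "exp (- (exponent l (a m) n - exponent l (a i) n)) = ?U i n / ?U m n" for n
      using i m assms term_pos[of i n] term_pos[of m n]
      by (auto simp: exp_diff subsetD simp flip: ln_term)
    ultimately show ?thesis by simp
  qed
  have "((\<lambda>n. \<Sum>i\<in>J. real_of_int (c i) * (?U i n / ?U m n)) \<longlongrightarrow>
        (\<Sum>i\<in>J. if i = m then real_of_int (c m) else 0)) sequentially"
  proof (rule tendsto_sum)
    fix i assume "i \<in> J"
    show "((\<lambda>n. real_of_int (c i) * (?U i n / ?U m n)) \<longlongrightarrow> (if i = m then real_of_int (c m) else 0)) sequentially"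
    proof (cases "i = m")
      case True
      moreover have "?U m n / ?U m n = 1" for n using term_pos[of m n] m assms by auto
      ultimately show ?thesis by (simp del: divide_self_if)
    next
      case False
      with tendsto_mult_left[OF ratio[OF \<open>i \<in> J\<close> False], of "real_of_int (c i)"] show ?thesis by simp
    qed
  qed
  also have "(\<Sum>i\<in>J. if i = m then real_of_int (c m) else 0) = real_of_int (c m)"
    using m finJ by simp
  also have "(\<lambda>n. \<Sum>i\<in>J. real_of_int (c i) * (?U i n / ?U m n)) = (\<lambda>n. real_of_int (partial_sum J n) / ?U m n)"
    by (simp add: partial_sum_def sum_divide_distrib)
  finally have "((\<lambda>n. \<bar>real_of_int (partial_sum J n) / ?U m n\<bar>) \<longlongrightarrow> \<bar>real_of_int (c m)\<bar>) sequentially"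
    by (rule tendsto_rabs)
  moreover have "1 / 2 < \<bar>real_of_int (c m)\<bar>"
    using coeff_nonzero[of m] m assms by auto
  ultimately have "\<forall>\<^sub>F n in sequentially. 1 / 2 < \<bar>real_of_int (partial_sum J n) / ?U m n\<bar>"
    by (rule order_tendstoD)
  then have "\<forall>\<^sub>F n in sequentially. ?U m n / 2 \<le> \<bar>real_of_int (partial_sum J n)\<bar>"
  proof (rule eventually_mono)
    fix n assume *: "1 / 2 < \<bar>real_of_int (partial_sum J n) / ?U m n\<bar>"
    have "0 < ?U m n" using term_pos[of m n] m assms by auto
    with * show "?U m n / 2 \<le> \<bar>real_of_int (partial_sum J n)\<bar>" by (simp add: field_simps)
  qed
  moreover have "filterlim (\<lambda>n. ln (?U m n) - ln (?U i n)) at_top sequentially"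
    if "i \<in> J" "i \<noteq> m" for i
    using dom[OF that] by (simp only: ln_term[OF m(1)] ln_term[OF that(1)])
  ultimately show ?thesis using m(1) by blast
qed

lemma eventually_partial_sums_nonzero:
  "\<forall>\<^sub>F n in sequentially. \<forall>J\<in>Pow I - {{}}. partial_sum J n \<noteq> 0"
proof (rule eventually_ball_finite)
  show "finite (Pow I - {{}})" using finite_I by simp
  show "\<forall>J\<in>Pow I - {{}}. \<forall>\<^sub>F n in sequentially. partial_sum J n \<noteq> 0"
  proof
    fix J assume J: "J \<in> Pow I - {{}}"
    then obtain m where m: "m \<in> J"
      "\<forall>\<^sub>F n in sequentially. real (superpow l (y m) n) / 2 \<le> \<bar>real_of_int (partial_sum J n)\<bar>"
      using dominant_term[of J] by blast
    from m(2) show "\<forall>\<^sub>F n in sequentially. partial_sum J n \<noteq> 0"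
    proof (rule eventually_mono)
      fix n assume "real (superpow l (y m) n) / 2 \<le> \<bar>real_of_int (partial_sum J n)\<bar>"
      moreover have "0 < superpow l (y m) n" using term_pos[of m n] m J by auto
      ultimately show "partial_sum J n \<noteq> 0" by auto
    qed
  qed
qed

text \<open>
  The term \<open>m\<close> has eventually the least \<open>q\<close>-adic valuation, and on the residue class of \<open>n0\<close> modulo
  \<open>N\<close> the valuation of the whole sum exceeds that of the term by less than the constant \<open>E\<close>.
\<close>

definition controls_multiplicity :: "nat \<Rightarrow> nat \<Rightarrow> 'i \<Rightarrow> nat \<Rightarrow> nat \<Rightarrow> bool" where
  "controls_multiplicity q n0 m E N \<longleftrightarrow> m \<in> I \<and> 0 < N \<and>
     (\<forall>i\<in>I. (\<forall>j\<in>{1..l}. multiplicity q (y i j) = multiplicity q (y m j)) \<or>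
        filterlim (\<lambda>n. real (multiplicity q (superpow l (y i) n)) - real (multiplicity q (superpow l (y m) n)))
          at_top sequentially) \<and>
     (\<forall>\<^sub>F n in sequentially. [n = n0] (mod N) \<longrightarrow>
        \<not> int q ^ (multiplicity q (superpow l (y m) n) + E) dvd partial_sum I n)"

text \<open>
  Let \<open>J\<close> be the set of terms whose valuation polynomial is the least one. Its partial sum is
  \<open>q ^ e m n * g n\<close>, where \<open>g\<close> involves only bases prime to \<open>q\<close> and is thus periodic modulo \<open>q ^ E\<close>.
  As \<open>g n0 \<noteq> 0\<close>, some \<open>q ^ E\<close> does not divide \<open>g n0\<close>, and then it divides no \<open>g n\<close> with \<open>n\<close> in the class
  of \<open>n0\<close>. All remaining terms are eventually divisible by \<open>q ^ (e m n + E)\<close>.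
\<close>

lemma multiplicity_bounded_in_progression:
  assumes q: "prime q" and I: "I \<noteq> {}"
    and nonzero: "\<And>J. J \<subseteq> I \<Longrightarrow> J \<noteq> {} \<Longrightarrow> partial_sum J n0 \<noteq> 0"
  shows "\<exists>m E N. controls_multiplicity q n0 m E N"
proof -
  define a where "a i j = real (multiplicity q (y i j))" for i j
  define e where "e i n = multiplicity q (superpow l (y i) n)" for i n
  have e_exponent: "real (e i n) = exponent l (a i) n" if "i \<in> I" for i n
    unfolding a_def e_def using q that base_pos by (intro real_multiplicity_superpow) auto
  obtain m where m: "m \<in> I" "\<And>i. i \<in> I \<Longrightarrow> (\<forall>j\<in>{1..l}. a i j = a m j) \<or>
      filterlim (\<lambda>n. exponent l (a i) n - exponent l (a m) n) at_top sequentially"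
    using eventually_least_exponent[OF finite_I I, of l a] by blast
  define J where "J = {i\<in>I. \<forall>j\<in>{1..l}. a i j = a m j}"
  have J: "J \<subseteq> I" "m \<in> J" by (auto simp: J_def m)
  have diverge: "filterlim (\<lambda>n. real (e i n) - real (e m n)) at_top sequentially" if "i \<in> I - J" for i
    using m that by (auto simp: J_def e_exponent)
  define w where "w i j = y i j div q ^ multiplicity q (y i j)" for i j
  have w_coprime: "coprime (w i j) q" if "i \<in> I" "j \<in> {1..l}" for i j
  proof -
    have "\<not> is_unit q" using q by (auto dest: prime_gt_1_nat)
    then have "\<not> q dvd w i j"
      unfolding w_def using base_pos[OF that] by (intro multiplicity_decompose) auto
    then show ?thesis using prime_imp_coprime[OF q] coprime_commute by blast
  qed
  have tied: "superpow l (y i) n = q ^ e m n * superpow l (w i) n" if "i \<in> J" for i n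
  proof -
    have "superpow l (y i) n = superpow l (\<lambda>j. q ^ multiplicity q (y m j) * w i j) n"
    proof (rule superpow_cong)
      fix j assume "j \<in> {1..l}"
      with that have "multiplicity q (y m j) = multiplicity q (y i j)"
        by (simp add: J_def a_def)
      then show "y i j = q ^ multiplicity q (y m j) * w i j"
        by (simp add: w_def multiplicity_dvd)
    qed
    also have "\<dots> = superpow l (\<lambda>j. q ^ multiplicity q (y m j)) n * superpow l (w i) n"
      by (rule superpow_mult)
    also have "superpow l (\<lambda>j. q ^ multiplicity q (y m j)) n = q ^ e m n"
      using m q base_pos unfolding e_def
      by (subst multiplicity_superpow) (auto simp: superpow_def power_mult power_sum)
    finally show ?thesis .
  qed
  define g where "g n = (\<Sum>i\<in>J. c i * int (superpow l (w i) n))" for n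
  have sum_J: "partial_sum J n = int q ^ e m n * g n" for n
    unfolding partial_sum_def g_def sum_distrib_left
    by (rule sum.cong) (auto simp: tied)
  have "g n0 \<noteq> 0" using nonzero[of J] J sum_J[of n0] by auto
  \<comment> \<open>The least exponent for which the prime power does not divide \<open>g n0\<close>.\<close>
  define E where "E = Suc (multiplicity (int q) (g n0))"
  have E: "\<not> int q ^ E dvd g n0"
    using \<open>g n0 \<noteq> 0\<close> prime_gt_1_nat[OF q]
    by (subst power_dvd_iff_le_multiplicity) (auto simp: E_def)
  define N where "N = totient (q ^ E)"
  have N: "0 < N" using q by (simp add: N_def prime_gt_0_nat)
  have g_cong: "[g n = g n0] (mod (int q ^ E))" if "[n = n0] (mod N)" for n
    unfolding g_def
  proof (intro cong_sum cong_mult cong_refl)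
    fix i assume "i \<in> J"
    then have "[superpow l (w i) n = superpow l (w i) n0] (mod (q ^ E))"
      using that w_coprime J by (intro superpow_cong_mod) (auto simp: N_def)
    then show "[int (superpow l (w i) n) = int (superpow l (w i) n0)] (mod (int q ^ E))"
      by (simp flip: cong_int_iff)
  qed
  have "\<forall>\<^sub>F n in sequentially. \<forall>i\<in>I - J. real E \<le> real (e i n) - real (e m n)"
    using finite_I diverge by (intro eventually_ball_finite) (auto simp: filterlim_at_top)
  then have "\<forall>\<^sub>F n in sequentially. [n = n0] (mod N) \<longrightarrow> \<not> int q ^ (e m n + E) dvd partial_sum I n"
  proof (rule eventually_mono, intro impI notI)
    fix n assume far: "\<forall>i\<in>I - J. real E \<le> real (e i n) - real (e m n)" and n: "[n = n0] (mod N)"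
      and dvd: "int q ^ (e m n + E) dvd partial_sum I n"
    have "int q ^ (e m n + E) dvd partial_sum (I - J) n"
      unfolding partial_sum_def
    proof (intro dvd_sum dvd_mult)
      fix i assume "i \<in> I - J"
      then have "e m n + E \<le> e i n" using far by force
      then have "q ^ (e m n + E) dvd superpow l (y i) n"
        unfolding e_def by (rule multiplicity_dvd')
      then show "int q ^ (e m n + E) dvd int (superpow l (y i) n)"
        by (metis int_dvd_int_iff of_nat_power)
    qed
    moreover have "partial_sum I n = partial_sum J n + partial_sum (I - J) n"
      unfolding partial_sum_def using sum.subset_diff[OF J(1) finite_I] by (simp only: add.commute)
    ultimately have "int q ^ (e m n + E) dvd partial_sum J n"
      using dvd by (simp add: dvd_add_left_iff)
    then have "int q ^ E dvd g n"
      using q by (simp add: sum_J power_add)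
    with E show False using cong_dvd_iff[OF g_cong[OF n]] by blast
  qed
  moreover have "\<forall>i\<in>I. (\<forall>j\<in>{1..l}. multiplicity q (y i j) = multiplicity q (y m j)) \<or>
      filterlim (\<lambda>n. real (e i n) - real (e m n)) at_top sequentially"
    using diverge by (auto simp: J_def a_def)
  ultimately show ?thesis using m(1) N unfolding e_def controls_multiplicity_def by blast
qed

section \<open>Integral sums of super-powers: new prime factors\<close>

definition base_primes :: "nat set" where
  "base_primes = (\<Union>i\<in>I. \<Union>j\<in>{1..l}. prime_factors (y i j))"

lemma finite_base_primes: "finite base_primes"
  using finite_I by (simp add: base_primes_def)

lemma prime_base_primes: "q \<in> base_primes \<Longrightarrow> prime q"
  by (auto simp: base_primes_def)

lemma base_primesI: "i \<in> I \<Longrightarrow> j \<in> {1..l} \<Longrightarrow> prime q \<Longrightarrow> q dvd y i j \<Longrightarrow> q \<in> base_primes"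
  using base_pos[of i j] unfolding base_primes_def
  by (intro UN_I[of i] UN_I[of j]) (simp_all add: in_prime_factors_iff)

lemma prime_factors_term: 
  assumes "i \<in> I"
  shows "prime_factors (superpow l (y i) n) \<subseteq> base_primes"
proof
  fix q assume "q \<in> prime_factors (superpow l (y i) n)"
  then have q: "prime q" "q dvd (\<Prod>j=1..l. y i j ^ (n ^ j))" by (auto simp: superpow_def)
  then obtain j where "j \<in> {1..l}" "q dvd y i j ^ (n ^ j)"
    using prime_dvd_prod_iff[of "{1..l}" q] by auto
  with q assms show "q \<in> base_primes" using prime_dvd_power base_primesI by blast
qed

text \<open>
  The lower bound \<open>U\<^sub>M(n) / 2\<close> for the sum is compared with the upper bound that holds if all of its
  primes lie in \<open>Q\<close>. On the logarithmic scale their difference is, up to the constant \<open>C\<close>, the sum over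
  \<open>q \<in> Q\<close> of \<open>gap M q\<close>, the excess of the valuation of the dominant term over the least valuation.
  Each gap is zero or tends to infinity. Not all of them are zero: otherwise any other term, which
  differs from the dominant one in some valuation, would outgrow it.
\<close>

lemma new_prime_factor:
  assumes two: "i1 \<in> I" "i2 \<in> I" "i1 \<noteq> i2"
    and nonzero: "\<And>J. J \<subseteq> I \<Longrightarrow> J \<noteq> {} \<Longrightarrow> partial_sum J n0 \<noteq> 0"
    and Q0: "finite Q0" "\<And>q. q \<in> Q0 \<Longrightarrow> prime q" and "0 < d"
  shows "\<exists>n\<ge>b. [n = n0] (mod d) \<and> partial_sum I n \<noteq> 0 \<and>
           (\<exists>q. prime q \<and> q \<notin> Q0 \<and> int q dvd partial_sum I n)"
proof -
  define Q where "Q = Q0 \<union> base_primes"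
  have Q: "finite Q" "\<And>q. q \<in> Q \<Longrightarrow> prime q"
    using Q0 finite_base_primes prime_base_primes by (auto simp: Q_def)
  have ln_pos: "0 < ln (real q)" if "q \<in> Q" for q
    using prime_gt_1_nat[OF Q(2)[OF that]] by simp
  define e where "e q i n = multiplicity q (superpow l (y i) n)" for q i n
  have "\<exists>m E N. controls_multiplicity q n0 m E N" if "q \<in> Q" for q
    using two nonzero by (intro multiplicity_bounded_in_progression[OF Q(2)[OF that]]) blast+
  then obtain m E N where controls: "\<And>q. q \<in> Q \<Longrightarrow> controls_multiplicity q n0 (m q) (E q) (N q)"
    by metis
  have m: "m q \<in> I" and N: "0 < N q" if "q \<in> Q" for q
    using controls[OF that] by (simp_all add: controls_multiplicity_def)
  have alternative: "(\<forall>j\<in>{1..l}. multiplicity q (y i j) = multiplicity q (y (m q) j)) \<or>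
      filterlim (\<lambda>n. real (e q i n) - real (e q (m q) n)) at_top sequentially" if "q \<in> Q" "i \<in> I" for q i
    using controls[OF that(1)] that(2) unfolding e_def controls_multiplicity_def by blast
  have bounded: "\<forall>\<^sub>F n in sequentially. [n = n0] (mod N q) \<longrightarrow>
      \<not> int q ^ (e q (m q) n + E q) dvd partial_sum I n" if "q \<in> Q" for q
    using controls[OF that] unfolding e_def controls_multiplicity_def by blast
  have ln_term: "ln (real (superpow l (y i) n)) = (\<Sum>q\<in>Q. ln q * real (e q i n))" if "i \<in> I" for i n
    unfolding e_def using Q prime_factors_term[OF that] term_pos[OF that]
    by (intro ln_eq_sum_multiplicity) (auto simp: Q_def)
  define gap where "gap i q n = ln (real q) * (real (e q i n) - real (e q (m q) n))" for i q n
  have gap: "if \<forall>j\<in>{1..l}. multiplicity q (y i j) = multiplicity q (y (m q) j)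
      then \<forall>n. gap i q n = 0 else filterlim (gap i q) at_top sequentially"
    if "q \<in> Q" "i \<in> I" for q i
  proof (cases "\<forall>j\<in>{1..l}. multiplicity q (y i j) = multiplicity q (y (m q) j)")
    case True
    have "e q i n = e q (m q) n" for n
      unfolding e_def using True that m Q base_pos 
      by (subst (1 2) multiplicity_superpow) auto
    then show ?thesis using True by (simp add: gap_def)
  next
    case False
    then show ?thesis unfolding gap_def
      using alternative[OF that] filterlim_tendsto_pos_mult_at_top[OF tendsto_const ln_pos[OF that(1)]]
      by auto
  qed
  have total_gap: "filterlim (\<lambda>n. \<Sum>q\<in>Q. gap i q n) at_top sequentially"
    if "i \<in> I" "q \<in> Q" "j \<in> {1..l}" "multiplicity q (y i j) \<noteq> multiplicity q (y (m q) j)" for i q j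
    using Q(1)
  proof (rule filterlim_sum_zero_or_at_top)
    show "filterlim (gap i q) at_top sequentially"
      using gap[OF that(2,1)] that(3,4) by (auto split: if_splits)
    show "(\<forall>n. gap i q n = 0) \<or> filterlim (gap i q) at_top sequentially" if "q \<in> Q" for q
      using gap[OF that \<open>i \<in> I\<close>] by (auto split: if_splits)
  qed fact
  obtain M where M: "M \<in> I"
    and dominant: "\<And>i. i \<in> I \<Longrightarrow> i \<noteq> M \<Longrightarrow> filterlim (\<lambda>n. ln (real (superpow l (y M) n)) - ln (real (superpow l (y i) n))) at_top sequentially"
    and large: "\<forall>\<^sub>F n in sequentially. real (superpow l (y M) n) / 2 \<le> \<bar>real_of_int (partial_sum I n)\<bar>"
    using dominant_term[of I] two by blast
  have "\<exists>q\<in>Q. \<exists>j\<in>{1..l}. multiplicity q (y M j) \<noteq> multiplicity q (y (m q) j)"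
  proof (rule ccontr)
    assume "\<not> ?thesis"
    then have tied: "multiplicity q (y M j) = multiplicity q (y (m q) j)" if "q \<in> Q" "j \<in> {1..l}" for q j
      using that by blast
    obtain i where i: "i \<in> I" "i \<noteq> M" using two by blast
    then obtain j where j: "j \<in> {1..l}" "y i j \<noteq> y M j" using bases_distinct M by blast
    have "\<exists>q\<in>Q. multiplicity q (y i j) \<noteq> multiplicity q (y M j)"
    proof (rule ccontr)
      assume "\<not> ?thesis"
      then have "(\<Prod>q\<in>Q. q ^ multiplicity q (y i j)) = (\<Prod>q\<in>Q. q ^ multiplicity q (y M j))"
        by simp
      moreover have "y i' j = (\<Prod>q\<in>Q. q ^ multiplicity q (y i' j))" if "i' \<in> I" for i'
        using Q base_pos[OF that j(1)] that j(1)
        by (intro nat_eq_prod_prime_powers) (auto simp: Q_def base_primes_def)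
      ultimately show False using i M j(2) by metis
    qed
    then obtain q where q: "q \<in> Q" "multiplicity q (y i j) \<noteq> multiplicity q (y (m q) j)"
      using tied j by auto
    \<comment> \<open>With all gaps of \<open>M\<close> zero, those of \<open>i\<close> compare \<open>i\<close> directly with \<open>M\<close>.\<close>
    have "gap M q n = 0" if "q \<in> Q" for q n
      using gap[OF that M] tied[OF that] by auto
    then have "(\<Sum>q\<in>Q. gap i q n) = (\<Sum>q\<in>Q. gap i q n - gap M q n)" for n
      by simp
    also have "\<dots> n = ln (real (superpow l (y i) n)) - ln (real (superpow l (y M) n))" for n
      by (simp add: ln_term i M gap_def right_diff_distrib flip: sum_subtractf)
    finally have "filterlim (\<lambda>n. ln (real (superpow l (y i) n)) - ln (real (superpow l (y M) n))) at_top sequentially"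
      using total_gap[OF i(1) q(1) j(1) q(2)] by simp
    from filterlim_at_top_add_at_top[OF this dominant[OF i]]
    have "filterlim (\<lambda>n. 0 :: real) at_top sequentially" by simp
    then have "\<forall>\<^sub>F n in sequentially. (1 :: real) \<le> 0" unfolding filterlim_at_top by blast
    then show False by simp
  qed
  then have total_gap_M: "filterlim (\<lambda>n. \<Sum>q\<in>Q. gap M q n) at_top sequentially"
    using total_gap[OF M] by blast
  \<comment> \<open>\<open>ln 2\<close> absorbs the factor \<open>1 / 2\<close> of the lower bound; \<open>1\<close> makes the final inequality strict.\<close>
  define C where "C = (\<Sum>q\<in>Q. ln (real q) * real (E q)) + ln 2 + 1"
  have "\<forall>\<^sub>F n in sequentially.
     real (superpow l (y M) n) / 2 \<le> \<bar>real_of_int (partial_sum I n)\<bar> \<and>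
     C \<le> (\<Sum>q\<in>Q. gap M q n) \<and>
     (\<forall>q\<in>Q. [n = n0] (mod N q) \<longrightarrow> \<not> int q ^ (e q (m q) n + E q) dvd partial_sum I n)"
    using large total_gap_M bounded Q(1)
    by (intro eventually_conj eventually_ball_finite) (auto simp: filterlim_at_top)
  then obtain n1 where n1: "\<And>n. n \<ge> n1 \<Longrightarrow>
     real (superpow l (y M) n) / 2 \<le> \<bar>real_of_int (partial_sum I n)\<bar> \<and>
     C \<le> (\<Sum>q\<in>Q. gap M q n) \<and>
     (\<forall>q\<in>Q. [n = n0] (mod N q) \<longrightarrow> \<not> int q ^ (e q (m q) n + E q) dvd partial_sum I n)"
    unfolding eventually_sequentially by blast
  define N' where "N' = d * (\<Prod>q\<in>Q. N q)"
  define n where "n = n0 + N' * (n1 + b)"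
  have "0 < N'" using N \<open>0 < d\<close> by (auto simp: N'_def intro!: prod_pos)
  then have "n1 + b \<le> N' * (n1 + b)" by simp
  then have "n1 + b \<le> n" unfolding n_def by (rule trans_le_add2)
  then have ge: "n1 \<le> n" "b \<le> n" by simp_all
  have cong: "[n = n0] (mod k)" if "k dvd N'" for k
    using that by (auto simp: n_def cong_def mult.assoc elim!: dvdE)
  let ?f = "nat \<bar>partial_sum I n\<bar>"
  have lower: "real (superpow l (y M) n) / 2 \<le> real ?f" using n1[OF ge(1)] by simp
  moreover have U_pos: "0 < real (superpow l (y M) n)" using term_pos[OF M] by simp
  ultimately have f_pos: "0 < ?f" by (cases "?f = 0") auto
  have not_dvd: "\<not> q ^ (e q (m q) n + E q) dvd ?f" if "q \<in> Q" for q
  proof -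
    have "N q dvd N'" unfolding N'_def using that Q(1) by (simp add: dvd_prodI)
    then have "[n = n0] (mod N q)" by (rule cong)
    then have "\<not> int q ^ (e q (m q) n + E q) dvd partial_sum I n"
      using n1[OF ge(1)] that by simp
    then show ?thesis by simp
  qed
  have "\<exists>q. prime q \<and> q \<notin> Q0 \<and> int q dvd partial_sum I n"
  proof (rule ccontr)
    assume "\<not> ?thesis"
    then have old: "q \<in> Q" if "prime q" "int q dvd partial_sum I n" for q
      using that unfolding Q_def by blast
    have "prime_factors ?f \<subseteq> Q"
    proof
      fix q assume "q \<in> prime_factors ?f"
      then have "prime q" "q dvd ?f" by auto
      then show "q \<in> Q" using old by simp
    qed
    then have "ln (real ?f) \<le> (\<Sum>q\<in>Q. ln (real q) * real (e q (m q) n + E q))"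
      using f_pos Q not_dvd by (intro ln_le_if_prime_powers_not_dvd) simp_all
    also have "\<dots> = (\<Sum>q\<in>Q. ln (real q) * real (e q M n)) - (\<Sum>q\<in>Q. gap M q n) + (\<Sum>q\<in>Q. ln (real q) * real (E q))"
      by (simp add: gap_def algebra_simps sum.distrib sum_subtractf)
    also have "\<dots> \<le> ln (real (superpow l (y M) n)) - ln 2 - 1"
      using n1[OF ge(1)] by (simp add: ln_term[OF M] C_def)
    also have "\<dots> = ln (real (superpow l (y M) n) / 2) - 1"
      using U_pos by (simp add: ln_div)
    also have "\<dots> \<le> ln (real ?f) - 1"
      using lower U_pos by simp
    finally show False by simp
  qed
  moreover have "partial_sum I n \<noteq> 0" using f_pos by auto
  moreover have "[n = n0] (mod d)" by (rule cong) (simp add: N'_def)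
  ultimately show ?thesis using ge by blast
qed

text \<open>
  Induction on the number of primes. A prime \<open>p\<close> that divides no base and divides the sum at \<open>n0\<close> still
  divides it at every \<open>n\<close> congruent to \<open>n0\<close> modulo \<open>p - 1\<close>, so new primes can be collected without
  losing the old ones. The set \<open>F\<close> makes room for primes that will be cancelled by a denominator.
\<close>

lemma unboundedly_many_prime_factors:
  assumes two: "i1 \<in> I" "i2 \<in> I" "i1 \<noteq> i2" and F: "finite F" and "0 < d"
  shows "\<exists>n\<ge>b. [n = r] (mod d) \<and> partial_sum I n \<noteq> 0 \<and>
           M \<le> card {q. prime q \<and> q \<notin> F \<and> int q dvd partial_sum I n}"
proof -
  obtain n1 where n1: "\<And>n J. n \<ge> n1 \<Longrightarrow> J \<subseteq> I \<Longrightarrow> J \<noteq> {} \<Longrightarrow> partial_sum J n \<noteq> 0"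
    using eventually_partial_sums_nonzero unfolding eventually_sequentially by auto
  define A where "A n = {q. prime q \<and> q \<notin> F \<union> base_primes \<and> int q dvd partial_sum I n}" for n
  have finite_A: "finite (A n)" if "n \<ge> n1" for n
    using finite_natural_divisors[of "partial_sum I n"] n1[OF that, of I] two
    by (auto simp: A_def intro: finite_subset[rotated])
  have "\<exists>n\<ge>max b n1. [n = r] (mod d) \<and> M \<le> card (A n)"
  proof (induction M)
    case 0
    have "max b n1 \<le> r + d * max b n1"
      using \<open>0 < d\<close> mult_right_mono[of 1 d "max b n1"] by linarith
    then show ?case by (intro exI[of _ "r + d * max b n1"]) (auto simp: cong_def)
  next
    case (Suc M)
    then obtain n0 where n0: "n0 \<ge> max b n1" "[n0 = r] (mod d)" "M \<le> card (A n0)" by blast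
    \<comment> \<open>The factor \<open>d\<close> keeps \<open>n\<close> in the given class, the factors \<open>q - 1\<close> keep the old primes.\<close>
    define d' where "d' = d * (\<Prod>q\<in>A n0. q - 1)"
    have "0 < d'" using \<open>0 < d\<close> by (auto simp: d'_def A_def prime_gt_Suc_0_nat intro!: prod_pos)
    moreover have "\<And>J. J \<subseteq> I \<Longrightarrow> J \<noteq> {} \<Longrightarrow> partial_sum J n0 \<noteq> 0" using n1 n0 by auto
    moreover have "finite ({q\<in>F. prime q} \<union> base_primes \<union> A n0)"
      using F finite_base_primes finite_A n0 by simp
    moreover have "prime q" if "q \<in> {q\<in>F. prime q} \<union> base_primes \<union> A n0" for q
      using that prime_base_primes by (auto simp: A_def)
    ultimately obtain n q where n: "n \<ge> max b n1" "[n = n0] (mod d')"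
      and q: "prime q" "q \<notin> {q\<in>F. prime q} \<union> base_primes \<union> A n0" "int q dvd partial_sum I n"
      using new_prime_factor[OF two, of n0 "{q\<in>F. prime q} \<union> base_primes \<union> A n0" d' "max b n1"] by blast
    have "A n0 \<subseteq> A n"
    proof
      fix p assume p: "p \<in> A n0"
      then have "prime p" by (simp add: A_def)
      have "p - 1 dvd d'" unfolding d'_def using p finite_A n0 by (auto intro: dvd_mult dvd_prodI)
      then have "[n = n0] (mod totient p)"
        using n(2) \<open>prime p\<close> by (simp add: totient_prime cong_dvd_modulus_nat)
      moreover have "coprime (y i j) p" if "i \<in> I" "j \<in> {1..l}" for i j
        using p base_primesI[OF that \<open>prime p\<close>] \<open>prime p\<close> prime_imp_coprime coprime_commute
        unfolding A_def by blast
      ultimately have "[superpow l (y i) n = superpow l (y i) n0] (mod p)" if "i \<in> I" for i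
        using that by (intro superpow_cong_mod) auto
      then have "[partial_sum I n = partial_sum I n0] (mod int p)"
        unfolding partial_sum_def by (intro cong_sum cong_mult cong_refl) (simp add: cong_int_iff)
      then show "p \<in> A n" using p by (auto simp: A_def cong_dvd_iff)
    qed
    moreover have "q \<in> A n" using q by (auto simp: A_def)
    ultimately have "insert q (A n0) \<subseteq> A n" by blast
    then have "card (insert q (A n0)) \<le> card (A n)" using finite_A n by (intro card_mono) auto
    moreover have "q \<notin> A n0" using q by blast
    ultimately have "Suc M \<le> card (A n)" using n0 finite_A by simp
    moreover have "[n = r] (mod d)"
      using n(2) n0(2) unfolding d'_def by (meson cong_dvd_modulus_nat cong_trans dvd_triv_left)
    ultimately show ?case using n by blast
  qed
  then obtain n where n: "n \<ge> max b n1" "[n = r] (mod d)" "M \<le> card (A n)" by blast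
  have nz: "partial_sum I n \<noteq> 0" using n1[of n I] n two by auto
  have "card (A n) \<le> card {q. prime q \<and> q \<notin> F \<and> int q dvd partial_sum I n}"
    using finite_natural_divisors[OF nz] by (intro card_mono) (auto simp: A_def intro: finite_subset[rotated])
  then show ?thesis using n nz by auto
qed

end

section \<open>The function \<open>\<omega>\<close> on fractions\<close>

lemma card_prime_divisors_le_omega_rat:
  fixes t d :: int
  assumes "t \<noteq> 0" "d \<noteq> 0"
  shows "enat (card {q::nat. prime q \<and> \<not> int q dvd d \<and> int q dvd t}) \<le> omega_rat (of_int t / of_int d)"
proof -
  obtain a b where ab: "quotient_of (of_int t / of_int d) = (a, b)" by fastforce
  have "b > 0" using quotient_of_denom_pos[OF ab] .
  have "(of_int t / of_int d :: rat) = of_int a / of_int b" using quotient_of_div[OF ab] .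
  then have "(of_int (t * b) :: rat) = of_int (a * d)"
    using \<open>b > 0\<close> assms by (simp add: field_simps)
  then have eq: "t * b = a * d" by (simp only: of_int_eq_iff)
  then have "a \<noteq> 0" using assms \<open>b > 0\<close> by auto
  have "int ` {q::nat. prime q \<and> \<not> int q dvd d \<and> int q dvd t} \<subseteq> prime_factors a"
  proof safe
    fix q :: nat assume q: "prime q" "\<not> int q dvd d" "int q dvd t"
    then have "int q dvd a * d" using eq by (metis dvd_mult2)
    then have "int q dvd a" using q by (simp add: prime_dvd_mult_iff)
    then show "int q \<in> prime_factors a" using q \<open>a \<noteq> 0\<close> by (simp add: in_prime_factors_iff)
  qed
  then have "card (int ` {q::nat. prime q \<and> \<not> int q dvd d \<and> int q dvd t}) \<le> card (prime_factors a)"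
    by (intro card_mono) auto
  then have "enat (card {q::nat. prime q \<and> \<not> int q dvd d \<and> int q dvd t}) \<le> omega_int a"
    using \<open>a \<noteq> 0\<close> by (simp add: omega_int_def card_image)
  also have "\<dots> \<le> omega_rat (of_int t / of_int d)"
    unfolding omega_rat_def ab by simp
  finally show ?thesis .
qed

lemma omega_rat_fraction_le:
  fixes t d :: int
  assumes "t \<noteq> 0" "d \<noteq> 0"
  shows "omega_rat (of_int t / of_int d) \<le> enat (card (prime_factors t) + card (prime_factors d))"
proof -
  obtain a b where ab: "quotient_of (of_int t / of_int d) = (a, b)" by fastforce
  have "b > 0" using quotient_of_denom_pos[OF ab] .
  have "coprime a b" using quotient_of_coprime[OF ab] .
  have "(of_int t / of_int d :: rat) = of_int a / of_int b" using quotient_of_div[OF ab] .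
  then have "(of_int (t * b) :: rat) = of_int (a * d)"
    using \<open>b > 0\<close> assms by (simp add: field_simps)
  then have eq: "t * b = a * d" by (simp only: of_int_eq_iff)
  then have "a \<noteq> 0" using assms \<open>b > 0\<close> by auto
  have "a dvd t" using eq \<open>coprime a b\<close> by (metis coprime_dvd_mult_left_iff dvd_triv_left)
  moreover have "b dvd d" using eq \<open>coprime a b\<close>
    by (metis coprime_commute coprime_dvd_mult_right_iff dvd_triv_right)
  ultimately have "card (prime_factors a) \<le> card (prime_factors t)" "card (prime_factors b) \<le> card (prime_factors d)"
    using assms by (simp_all add: card_mono dvd_prime_factors)
  then show ?thesis
    unfolding omega_rat_def ab using \<open>a \<noteq> 0\<close> \<open>b > 0\<close> by (simp add: omega_int_def)
qed

lemma omega_rat_product_of_superpowers_bounded: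
  fixes a :: "nat \<Rightarrow> rat"
  assumes "\<forall>j\<le>l. a j \<noteq> 0"
  shows "\<exists>B. \<forall>n. omega_rat (\<Prod>j=0..l. a j ^ (n ^ j)) \<le> enat B"
proof -
  define u v where "u j = fst (quotient_of (a j))" and "v j = snd (quotient_of (a j))" for j
  have a: "a j = of_int (u j) / of_int (v j)" for j
    unfolding u_def v_def by (rule quotient_of_div) simp
  have v: "v j \<noteq> 0" for j using quotient_of_denom_pos'[of "a j"] by (simp add: v_def)
  have u: "u j \<noteq> 0" if "j \<le> l" for j using assms a[of j] that by force
  let ?P = "\<lambda>w. \<Union>j\<in>{0..l}. prime_factors (w j :: int)"
  have primes: "card (prime_factors (\<Prod>j=0..l. w j ^ (n ^ j))) \<le> card (?P w)"
    if w: "\<And>j. j \<le> l \<Longrightarrow> w j \<noteq> 0" for w n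
  proof (rule card_mono)
    show "prime_factors (\<Prod>j=0..l. w j ^ (n ^ j)) \<subseteq> ?P w"
    proof
      fix q assume "q \<in> prime_factors (\<Prod>j=0..l. w j ^ (n ^ j))"
      then have q: "prime q" "q dvd (\<Prod>j=0..l. w j ^ (n ^ j))" by auto
      then obtain j where j: "j \<in> {0..l}" "q dvd w j ^ (n ^ j)"
        using prime_dvd_prod_iff[of "{0..l}" q] by auto
      then have "q dvd w j" using q prime_dvd_power by blast
      then have "q \<in> prime_factors (w j)" using q w j by (simp add: in_prime_factors_iff)
      then show "q \<in> ?P w" using j by blast
    qed
  qed simp
  have "omega_rat (\<Prod>j=0..l. a j ^ (n ^ j)) \<le> enat (card (?P u) + card (?P v))" for n
  proof -
    have "(\<Prod>j=0..l. a j ^ (n ^ j)) = of_int (\<Prod>j=0..l. u j ^ (n ^ j)) / of_int (\<Prod>j=0..l. v j ^ (n ^ j))"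
      by (simp add: a power_divide prod_dividef)
    then have "omega_rat (\<Prod>j=0..l. a j ^ (n ^ j)) \<le> enat (card (prime_factors (\<Prod>j=0..l. u j ^ (n ^ j)))
        + card (prime_factors (\<Prod>j=0..l. v j ^ (n ^ j))))"
      using u v omega_rat_fraction_le[of "\<Prod>j=0..l. u j ^ (n ^ j)" "\<Prod>j=0..l. v j ^ (n ^ j)"] by simp
    also have "\<dots> \<le> enat (card (?P u) + card (?P v))"
      using primes[of u n] primes[of v n] u v by simp
    finally show ?thesis .
  qed
  then show ?thesis by blast
qed

section \<open>Rational sums of super-powers\<close>

lemma common_denominator:
  fixes A :: "rat set"
  assumes "finite A"
  shows "\<exists>D::nat. 0 < D \<and> (\<forall>a\<in>A. of_nat D * a \<in> \<int>)"
  using assms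
proof induction
  case (insert a A)
  then obtain D :: nat where D: "0 < D" "\<And>a. a \<in> A \<Longrightarrow> of_nat D * a \<in> \<int>" by blast
  obtain u v where uv: "quotient_of a = (u, v)" by fastforce
  have v: "v > 0" using quotient_of_denom_pos[OF uv] .
  have "of_nat (D * nat v) * a = of_int (int D * u)"
    using v quotient_of_div[OF uv] by simp
  then have "of_nat (D * nat v) * a \<in> \<int>" by (metis Ints_of_int)
  moreover have "of_nat (D * nat v) * b \<in> \<int>" if "b \<in> A" for b
  proof -
    have "of_nat (D * nat v) * b = of_nat (nat v) * (of_nat D * b)" by simp
    then show ?thesis using D(2)[OF that] by (metis Ints_mult Ints_of_nat)
  qed
  ultimately show ?case using D(1) v by (intro exI[of _ "D * nat v"]) auto
qed auto

text \<open>
  Multiplying all bases and coefficients by a common denominator \<open>D\<close> multiplies the sum by a power of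
  \<open>D\<close>. This affects only the primes dividing \<open>D\<close>, which are a fixed finite set.
\<close>

lemma omega_rat_superpower_sum_unbounded:
  fixes z :: "'i \<Rightarrow> nat \<Rightarrow> rat" and c :: "'i \<Rightarrow> rat"
  assumes T: "finite T" "t1 \<in> T" "t2 \<in> T" "t1 \<noteq> t2"
    and pos: "\<And>t j. t \<in> T \<Longrightarrow> j \<in> {1..l} \<Longrightarrow> 0 < z t j"
    and c: "\<And>t. t \<in> T \<Longrightarrow> c t \<noteq> 0"
    and distinct: "\<And>t t'. t \<in> T \<Longrightarrow> t' \<in> T \<Longrightarrow> t \<noteq> t' \<Longrightarrow> \<exists>j\<in>{1..l}. z t j \<noteq> z t' j"
    and "0 < d"
  shows "\<exists>n\<ge>1. [n = r] (mod d) \<and> enat M \<le> omega_rat (\<Sum>t\<in>T. c t * superpow l (z t) n)"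
proof -
  have "finite (c ` T \<union> (\<Union>t\<in>T. z t ` {1..l}))" using T by simp
  from common_denominator[OF this] obtain D :: nat where D: "0 < D"
    and D_int: "\<forall>a\<in>c ` T \<union> (\<Union>t\<in>T. z t ` {1..l}). of_nat D * a \<in> \<int>"
    by blast
  have int: "of_nat D * c t \<in> \<int>" "j \<in> {1..l} \<Longrightarrow> of_nat D * z t j \<in> \<int>" if "t \<in> T" for t j
    using D_int that by (auto simp: ball_Un)
  define y where "y t j = nat \<lfloor>of_nat D * z t j\<rfloor>" for t j
  define k where "k t = \<lfloor>of_nat D * c t\<rfloor>" for t
  have k: "of_int (k t) = of_nat D * c t" if "t \<in> T" for t
    using int(1)[OF that] by (auto simp: k_def elim: Ints_cases)
  have y: "of_nat (y t j) = of_nat D * z t j" if tj: "t \<in> T" "j \<in> {1..l}" for t j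
  proof -
    obtain w where w: "of_nat D * z t j = of_int w" using int(2)[OF tj] by (rule Ints_cases)
    moreover have "0 < of_nat D * z t j" using pos[OF that] D by simp
    ultimately show ?thesis by (simp add: y_def)
  qed
  interpret superpower_sum l T y k
  proof
    show "finite T" by fact
    show "0 < y t j" if "t \<in> T" "j \<in> {1..l}" for t j
    proof -
      have "0 < (of_nat (y t j) :: rat)" using y[OF that] pos[OF that] D by simp
      then show ?thesis by simp
    qed
    show "k t \<noteq> 0" if "t \<in> T" for t
      using k[OF that] c[OF that] D by auto
    show "\<exists>j\<in>{1..l}. y t j \<noteq> y t' j" if tt': "t \<in> T" "t' \<in> T" "t \<noteq> t'" for t t'
    proof -
      obtain j where "j \<in> {1..l}" "z t j \<noteq> z t' j" using distinct[OF tt'] by blast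
      moreover from this have "(of_nat (y t j) :: rat) \<noteq> of_nat (y t' j)"
        using y tt' D by simp
      ultimately show ?thesis by auto
    qed
  qed
  have "finite (prime_factors D)" by simp
  from unboundedly_many_prime_factors[OF T(2-4) this \<open>0 < d\<close>, of 1 r M]
  obtain n where n: "n \<ge> 1" "[n = r] (mod d)" "partial_sum T n \<noteq> 0"
    and M: "M \<le> card {q. prime q \<and> q \<notin> prime_factors D \<and> int q dvd partial_sum T n}"
    by blast
  define E where "E = D * superpow l (\<lambda>_. D) n"
  have E: "0 < E" using D by (simp add: E_def superpow_pos)
  have scaled: "of_nat (superpow l (y t) n) = superpow l (\<lambda>j. of_nat D * z t j) n" if "t \<in> T" for t
    unfolding of_nat_superpow by (rule superpow_cong) (rule y[OF that])
  have "of_int (partial_sum T n) = (\<Sum>t\<in>T. (of_nat D * c t) * superpow l (\<lambda>j. of_nat D * z t j) n)"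
    unfolding partial_sum_def of_int_sum of_int_mult of_int_of_nat_eq
    by (intro sum.cong refl) (simp only: k scaled)
  also have "\<dots> = of_nat E * (\<Sum>t\<in>T. c t * superpow l (z t) n)"
    by (simp add: superpow_mult E_def of_nat_superpow sum_distrib_left mult_ac)
  finally have sum: "(\<Sum>t\<in>T. c t * superpow l (z t) n) = of_int (partial_sum T n) / of_int (int E)"
    using E by (simp add: field_simps)
  have "E = D ^ Suc (\<Sum>j=1..l. n ^ j)" by (simp add: E_def superpow_def power_sum)
  then have "q dvd D" if "prime q" "int q dvd int E" for q
    using that prime_dvd_power[of q D "Suc (\<Sum>j=1..l. n ^ j)"] by (simp only: int_dvd_int_iff)
  then have "{q. prime q \<and> q \<notin> prime_factors D \<and> int q dvd partial_sum T n}
      \<subseteq> {q. prime q \<and> \<not> int q dvd int E \<and> int q dvd partial_sum T n}"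
    using D by (auto simp: in_prime_factors_iff)
  moreover have "finite {q. prime q \<and> \<not> int q dvd int E \<and> int q dvd partial_sum T n}"
    using finite_natural_divisors[OF n(3)] by (rule finite_subset[rotated]) auto
  ultimately have "card {q. prime q \<and> q \<notin> prime_factors D \<and> int q dvd partial_sum T n}
      \<le> card {q. prime q \<and> \<not> int q dvd int E \<and> int q dvd partial_sum T n}"
    by (intro card_mono)
  then have "enat M \<le> enat (card {q. prime q \<and> \<not> int q dvd int E \<and> int q dvd partial_sum T n})"
    using M by simp
  also have "\<dots> \<le> omega_rat (\<Sum>t\<in>T. c t * superpow l (z t) n)"
    unfolding sum using n(3) E by (intro card_prime_divisors_le_omega_rat) auto
  finally show ?thesis using n by blast
qed

text \<open>
  The parity of \<open>n ^ j\<close> depends only on that of \<open>n\<close>, so on a parity class the sign is part of the constant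
  coefficient.
\<close>

lemma superpower_product_sign_abs:
  fixes x :: "nat \<Rightarrow> rat"
  assumes nz: "\<And>j. j \<le> l \<Longrightarrow> x j \<noteq> 0" and "[n = r] (mod 2)"
  shows "(\<Prod>j=0..l. x j ^ (n ^ j)) = (\<Prod>j=0..l. sgn (x j) ^ (r ^ j)) * \<bar>x 0\<bar> * superpow l (\<lambda>j. \<bar>x j\<bar>) n"
proof -
  have "even n \<longleftrightarrow> even r" using assms(2) by (simp add: cong_def even_iff_mod_2_eq_zero)
  then have parity: "even (n ^ j) \<longleftrightarrow> even (r ^ j)" for j by simp
  have "x j ^ (n ^ j) = sgn (x j) ^ (r ^ j) * \<bar>x j\<bar> ^ (n ^ j)" if "j \<le> l" for j
  proof -
    have "sgn (x j) = 1 \<or> sgn (x j) = - 1" using nz[OF that] by (simp add: sgn_if)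
    then have "sgn (x j) ^ (n ^ j) = sgn (x j) ^ (r ^ j)"
      using parity[of j] by (auto simp: minus_one_power_iff simp del: even_power)
    then show ?thesis by (metis power_mult_distrib sgn_mult_abs)
  qed
  then have "(\<Prod>j=0..l. x j ^ (n ^ j)) = (\<Prod>j=0..l. sgn (x j) ^ (r ^ j)) * (\<Prod>j=0..l. \<bar>x j\<bar> ^ (n ^ j))"
    by (simp flip: prod.distrib)
  also have "(\<Prod>j=0..l. \<bar>x j\<bar> ^ (n ^ j)) = \<bar>x 0\<bar> * superpow l (\<lambda>j. \<bar>x j\<bar>) n"
    by (simp add: superpow_def prod.atLeast_Suc_atMost)
  finally show ?thesis by simp
qed

text \<open>
  The summands are merged along the tuples of absolute values of their bases. The tuples are set to \<open>0\<close>
  outside \<open>{1..l}\<close>, so that different tuples differ at an index that matters.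
\<close>

lemma exp_poly_sum_grouped:
  obtains T :: "(nat \<Rightarrow> rat) set" and C where "finite T"
    and "\<And>t. t \<in> T \<Longrightarrow> C t \<noteq> 0"
    and "\<And>t j. t \<in> T \<Longrightarrow> j \<in> {1..l} \<Longrightarrow> 0 < t j"
    and "\<And>t t'. t \<in> T \<Longrightarrow> t' \<in> T \<Longrightarrow> t \<noteq> t' \<Longrightarrow> \<exists>j\<in>{1..l}. t j \<noteq> t' j"
    and "\<And>n. n \<ge> 1 \<Longrightarrow> [n = r] (mod 2) \<Longrightarrow> exp_poly_sum k l x n = (\<Sum>t\<in>T. C t * superpow l t n)"
proof -
  define K where "K = {i\<in>{1..k}. \<forall>j\<le>l. x i j \<noteq> 0}"
  define \<tau> where "\<tau> i j = (if j \<in> {1..l} then \<bar>x i j\<bar> else 0)" for i j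
  define \<gamma> where "\<gamma> i = (\<Prod>j=0..l. sgn (x i j) ^ (r ^ j)) * \<bar>x i 0\<bar>" for i
  define C where "C t = (\<Sum>i\<in>{i\<in>K. \<tau> i = t}. \<gamma> i)" for t
  define T where "T = {t\<in>\<tau> ` K. C t \<noteq> 0}"
  have "finite K" by (simp add: K_def)
  have sum: "exp_poly_sum k l x n = (\<Sum>t\<in>T. C t * superpow l t n)" if n: "n \<ge> 1" "[n = r] (mod 2)" for n
  proof -
    have "exp_poly_sum k l x n = (\<Sum>i\<in>K. \<Prod>j=0..l. x i j ^ (n ^ j))"
      unfolding exp_poly_sum_def using n(1) by (intro sum.mono_neutral_right) (auto simp: K_def)
    also have "\<dots> = (\<Sum>i\<in>K. \<gamma> i * superpow l (\<tau> i) n)"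
    proof (rule sum.cong)
      fix i assume "i \<in> K"
      then have "(\<Prod>j=0..l. x i j ^ (n ^ j)) = \<gamma> i * superpow l (\<lambda>j. \<bar>x i j\<bar>) n"
        unfolding \<gamma>_def using n by (intro superpower_product_sign_abs) (auto simp: K_def)
      also have "superpow l (\<lambda>j. \<bar>x i j\<bar>) n = superpow l (\<tau> i) n"
        by (rule superpow_cong) (simp add: \<tau>_def)
      finally show "(\<Prod>j=0..l. x i j ^ (n ^ j)) = \<gamma> i * superpow l (\<tau> i) n" .
    qed simp
    also have "\<dots> = (\<Sum>t\<in>\<tau> ` K. \<Sum>i\<in>{i\<in>K. \<tau> i = t}. \<gamma> i * superpow l (\<tau> i) n)"
      using \<open>finite K\<close> by (rule sum.image_gen)
    also have "\<dots> = (\<Sum>t\<in>\<tau> ` K. C t * superpow l t n)"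
      by (intro sum.cong) (auto simp: C_def sum_distrib_right)
    also have "\<dots> = (\<Sum>t\<in>T. C t * superpow l t n)"
      using \<open>finite K\<close> by (intro sum.mono_neutral_right) (auto simp: T_def)
    finally show ?thesis .
  qed
  have distinct: "\<exists>j\<in>{1..l}. t j \<noteq> t' j" if tt': "t \<in> T" "t' \<in> T" "t \<noteq> t'" for t t'
  proof -
    obtain j where j: "t j \<noteq> t' j" using \<open>t \<noteq> t'\<close> by blast
    moreover from this have "j \<in> {1..l}"
      using tt' unfolding T_def \<tau>_def by (auto split: if_splits)
    ultimately show ?thesis by blast
  qed
  show thesis
  proof (rule that)
    show "finite T" using \<open>finite K\<close> by (simp add: T_def)
    show "C t \<noteq> 0" if "t \<in> T" for t using that by (simp add: T_def)
    show "0 < t j" if "t \<in> T" "j \<in> {1..l}" for t j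
      using that by (auto simp: T_def K_def \<tau>_def)
  qed (fact distinct sum)+
qed

lemma superpower_product_if_omega_bounded:
  assumes "1 \<le> r" and bounded: "\<And>n. n \<ge> 1 \<Longrightarrow> [n = r] (mod 2) \<Longrightarrow> omega_rat (exp_poly_sum k l x n) \<le> enat B"
  shows "\<exists>a :: nat \<Rightarrow> rat. (\<forall>j\<le>l. a j \<noteq> 0) \<and>
           (\<forall>n\<ge>1. [n = r] (mod 2) \<longrightarrow> exp_poly_sum k l x n = (\<Prod>j=0..l. a j ^ (n ^ j)))"
proof (rule exp_poly_sum_grouped[of l r k x])
  fix T :: "(nat \<Rightarrow> rat) set" and C
  assume T: "finite T"
    and C: "\<And>t. t \<in> T \<Longrightarrow> C t \<noteq> 0"
    and pos: "\<And>t j. t \<in> T \<Longrightarrow> j \<in> {1..l} \<Longrightarrow> 0 < t j"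
    and distinct: "\<And>t t'. t \<in> T \<Longrightarrow> t' \<in> T \<Longrightarrow> t \<noteq> t' \<Longrightarrow> \<exists>j\<in>{1..l}. t j \<noteq> t' j"
    and sum: "\<And>n. n \<ge> 1 \<Longrightarrow> [n = r] (mod 2) \<Longrightarrow> exp_poly_sum k l x n = (\<Sum>t\<in>T. C t * superpow l t n)"
  have "T \<noteq> {}"
  proof
    assume "T = {}"
    then have "exp_poly_sum k l x r = 0" using sum[of r] \<open>1 \<le> r\<close> by simp
    then show False using bounded[of r] \<open>1 \<le> r\<close> by (simp add: omega_rat_def omega_int_def)
  qed
  then obtain t where "t \<in> T" by blast
  have "t' = t" if "t' \<in> T" for t'
  proof (rule ccontr)
    assume "t' \<noteq> t"
    have "\<exists>n\<ge>1. [n = r] (mod 2) \<and> enat (Suc B) \<le> omega_rat (\<Sum>t\<in>T. C t * superpow l t n)"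
      using T that \<open>t \<in> T\<close> \<open>t' \<noteq> t\<close>
      by (rule omega_rat_superpower_sum_unbounded) (fact pos C distinct | simp)+
    then obtain n where "n \<ge> 1" "[n = r] (mod 2)" "enat (Suc B) \<le> omega_rat (\<Sum>t\<in>T. C t * superpow l t n)"
      by auto
    then have "enat (Suc B) \<le> enat B" using bounded[of n] sum[of n] by (metis order_trans)
    then show False by simp
  qed
  then have "T = {t}" using \<open>t \<in> T\<close> by blast
  define a where "a j = (if j = 0 then C t else t j)" for j
  have "a j \<noteq> 0" if "j \<le> l" for j
    using C[OF \<open>t \<in> T\<close>] pos[OF \<open>t \<in> T\<close>, of j] that by (auto simp: a_def)
  moreover have "exp_poly_sum k l x n = (\<Prod>j=0..l. a j ^ (n ^ j))" if "n \<ge> 1" "[n = r] (mod 2)" for n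
  proof -
    have "(\<Prod>j=0..l. a j ^ (n ^ j)) = a 0 * superpow l a n"
      by (simp add: superpow_def prod.atLeast_Suc_atMost)
    also have "superpow l a n = superpow l t n"
      by (rule superpow_cong) (simp add: a_def)
    finally show ?thesis using sum[OF that] \<open>T = {t}\<close> by (simp add: a_def)
  qed
  ultimately show ?thesis by blast
qed

section \<open>The characterisation of bounded \<open>\<omega>\<close>\<close>

theorem corollary2:
  fixes k l :: nat and x :: "nat \<Rightarrow> nat \<Rightarrow> rat"
  assumes "k \<ge> 1" and "l \<ge> 1"
  shows "(\<exists>B::nat. \<forall>n\<ge>1. omega_rat (exp_poly_sum k l x n) \<le> enat B) \<longleftrightarrow>
    (\<exists>a b :: nat \<Rightarrow> rat. (\<forall>j\<le>l. a j \<noteq> 0 \<and> b j \<noteq> 0) \<and>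
      (\<forall>n\<ge>1. exp_poly_sum k l x (2 * n) = (\<Prod>j=0..l. a j ^ ((2 * n) ^ j)) \<and>
             exp_poly_sum k l x (2 * n - 1) = (\<Prod>j=0..l. b j ^ ((2 * n - 1) ^ j))))"
    (is "?bounded \<longleftrightarrow> ?product")
proof
  assume ?bounded
  then obtain B where B: "\<And>n. n \<ge> 1 \<Longrightarrow> omega_rat (exp_poly_sum k l x n) \<le> enat B" by blast
  obtain a :: "nat \<Rightarrow> rat" where a: "\<forall>j\<le>l. a j \<noteq> 0"
    "\<And>n. n \<ge> 1 \<Longrightarrow> [n = 2] (mod 2) \<Longrightarrow> exp_poly_sum k l x n = (\<Prod>j=0..l. a j ^ (n ^ j))"
    using superpower_product_if_omega_bounded[of 2 k l x B] B by auto
  obtain b :: "nat \<Rightarrow> rat" where b: "\<forall>j\<le>l. b j \<noteq> 0"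
    "\<And>n. n \<ge> 1 \<Longrightarrow> [n = 1] (mod 2) \<Longrightarrow> exp_poly_sum k l x n = (\<Prod>j=0..l. b j ^ (n ^ j))"
    using superpower_product_if_omega_bounded[of 1 k l x B] B by auto
  have "[2 * n = 2] (mod 2)" "[2 * n - 1 = 1] (mod 2)" if "n \<ge> 1" for n :: nat
    using that by (simp add: cong_def, simp add: cong_def) presburger
  then show ?product using a b by (intro exI[of _ a] exI[of _ b]) auto
next
  assume ?product
  then obtain a b :: "nat \<Rightarrow> rat" where nz: "\<forall>j\<le>l. a j \<noteq> 0" "\<forall>j\<le>l. b j \<noteq> 0"
    and even: "\<And>n. n \<ge> 1 \<Longrightarrow> exp_poly_sum k l x (2 * n) = (\<Prod>j=0..l. a j ^ ((2 * n) ^ j))"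
    and odd: "\<And>n. n \<ge> 1 \<Longrightarrow> exp_poly_sum k l x (2 * n - 1) = (\<Prod>j=0..l. b j ^ ((2 * n - 1) ^ j))"
    by blast
  obtain A where A: "\<And>n. omega_rat (\<Prod>j=0..l. a j ^ (n ^ j)) \<le> enat A"
    using omega_rat_product_of_superpowers_bounded[OF nz(1)] by blast
  obtain B where B: "\<And>n. omega_rat (\<Prod>j=0..l. b j ^ (n ^ j)) \<le> enat B"
    using omega_rat_product_of_superpowers_bounded[OF nz(2)] by blast
  have "omega_rat (exp_poly_sum k l x n) \<le> enat (max A B)" if "n \<ge> 1" for n
  proof (cases "even n")
    case True
    then obtain m where "n = 2 * m" by blast
    with that have "omega_rat (exp_poly_sum k l x n) \<le> enat A" using even[of m] A[of n] by simp
    also have "\<dots> \<le> enat (max A B)" by simp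
    finally show ?thesis .
  next
    case False
    then obtain m where "n = 2 * m + 1" by (rule oddE)
    then have "n = 2 * Suc m - 1" by simp
    then have "omega_rat (exp_poly_sum k l x n) \<le> enat B" using odd[of "Suc m"] B[of n] by simp
    also have "\<dots> \<le> enat (max A B)" by simp
    finally show ?thesis .
  qed
  then show ?bounded by blast
qed

end
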